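(* Let $S$ be a semiring. Then $S$ is exact if and only if the following two conditions hold for all positive integers $m,n$ and all $A\in S^{m\times n}$. (H1) Every right linear function $\operatorname{Col}(A)\to S$ extends to a right linear function $S^{m\times 1}\to S$. (H2) Every left linear function $\operatorname{Row}(A)\to S$ extends to a left linear function $S^{1\times n}\to S$.
   Context: A semiring is a set $S$ with a commutative associative addition and an associative (not necessarily commutative) multiplication distributing over addition from both sides, such that for every non-empty finite subset $L\subseteq S$ there are local identities $0_L,1_L\in S$ with $a+0_Lb=1_La=a$ and $a+b0_L=a1_L=a$ for all $a,b\in L$. (No global zero or identity is required.) $S^{m\times n}$ is the set of $m\times n$ matrices over $S$, with the usual matrix addition and multiplication. For $A\in S^{m\times n}$, $\operatorname{Row}(A)=\{uA: u\in S^{1\times m}\}\subseteq S^{1\times n}$ and $\operatorname{Col}(A)=\{Av: v\in S^{n\times 1}\}\subseteq S^{m\times 1}$. $S^{1\times n}$ and row spaces carry the left action of $S$; $S^{m\times 1}$ and column spaces carry the right action of $S$; $S$ itself carries both. A function $\phi$ is left linear if $\phi(ax+by)=a(\phi x)+b(\phi y)$, and right linear if $\phi(xa+yb)=(\phi x)a+(\phi y)b$, for all elements $x,y$ of the domain and all $a,b\in S$. $S$ is exact if for all positive integers $m,n$ and all $A\in S^{m\times n}$: (E1) if $x\in S^{1\times n}\setminus\operatorname{Row}(A)$ then there are $v,v'\in S^{n\times 1}$ with $Av=Av'$ but $xv\neq xv'$; and (E2) if $y\in S^{m\times 1}\setminus\operatorname{Col}(A)$ then there are $u,u'\in S^{1\times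 m}$ with $uA=u'A$ but $uy\neq u'y$. *)

theory Defs
  imports "Jordan_Normal_Form.Matrix"
begin

text \<open>The library class \<open>semiring\<close> has neither a zero nor a one; the local identities are added here.
  The same \<open>z\<close> (and \<open>e\<close>) serves on both sides.\<close>

class local_semiring = semiring +
  assumes local_identities:
    "finite L \<Longrightarrow> L \<noteq> {} \<Longrightarrow>
      \<exists>z e. \<forall>a\<in>L. \<forall>b\<in>L. a + z * b = a \<and> e * a = a \<and> a + b * z = a \<and> a * e = a"

text \<open>Without a zero there are no empty sums, so the library's \<open>sum\<close> and matrix product (which need
  \<open>comm_monoid_add\<close> and \<open>semiring_0\<close>) are unavailable. \<open>sum_upto f k\<close> is \<open>f 0 + \<dots> + f k\<close>.\<close>

primrec sum_upto :: "(nat \<Rightarrow> 'a::semigroup_add) \<Rightarrow> nat \<Rightarrow> 'a" where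
  "sum_upto f 0 = f 0"
| "sum_upto f (Suc k) = sum_upto f k + f (Suc k)"

text \<open>Meaningful only if \<open>dim_col A = dim_row B > 0\<close>.\<close>

definition mat_prod :: "'a::semiring mat \<Rightarrow> 'a mat \<Rightarrow> 'a mat" (infixl "*\<^sub>m" 70) where
  "A *\<^sub>m B = mat (dim_row A) (dim_col B)
     (\<lambda>(i, j). sum_upto (\<lambda>k. A $$ (i, k) * B $$ (k, j)) (dim_col A - 1))"

lemma sum_upto_eq_sum: "sum_upto f k = (\<Sum>i\<le>k. f i)" for f :: "nat \<Rightarrow> 'a::comm_monoid_add"
  by (induction k) simp_all

lemma mat_prod_eq_times:
  fixes A B :: "'a::semiring_0 mat"
  assumes "A \<in> carrier_mat l m" "B \<in> carrier_mat m n" "m > 0"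
  shows "A *\<^sub>m B = A * B"
proof (rule eq_matI)
  have m: "{..m - Suc 0} = {0..<m}" using assms(3) by auto
  fix i j assume "i < dim_row (A * B)" "j < dim_col (A * B)"
  then show "(A *\<^sub>m B) $$ (i, j) = (A * B) $$ (i, j)"
    using assms by (simp add: mat_prod_def sum_upto_eq_sum scalar_prod_def m)
qed (use assms in \<open>simp_all add: mat_prod_def\<close>)

text \<open>The left action of a scalar on matrices is the library's \<open>\<cdot>\<^sub>m\<close>; this is the right action.\<close>

definition right_smult_mat :: "'a::times mat \<Rightarrow> 'a \<Rightarrow> 'a mat" (infixl "\<cdot>\<^sub>r" 70) where
  "A \<cdot>\<^sub>r a = map_mat (\<lambda>s. s * a) A"

definition row_space :: "'a::semiring mat \<Rightarrow> 'a mat set" where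
  "row_space A = {u *\<^sub>m A | u. u \<in> carrier_mat 1 (dim_row A)}"

definition col_space :: "'a::semiring mat \<Rightarrow> 'a mat set" where
  "col_space A = {A *\<^sub>m v | v. v \<in> carrier_mat (dim_col A) 1}"

text \<open>Linearity of functions \<open>D \<rightarrow> S\<close>; values of \<open>\<phi>\<close> outside \<open>D\<close> are irrelevant provided
  \<open>D\<close> is closed under the respective linear combinations, as row and column spaces are.\<close>

definition left_linear_on :: "'a::semiring mat set \<Rightarrow> ('a mat \<Rightarrow> 'a) \<Rightarrow> bool" where
  "left_linear_on D \<phi> \<longleftrightarrow>
     (\<forall>x\<in>D. \<forall>y\<in>D. \<forall>a b. \<phi> (a \<cdot>\<^sub>m x + b \<cdot>\<^sub>m y) = a * \<phi> x + b * \<phi> y)"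

definition right_linear_on :: "'a::semiring mat set \<Rightarrow> ('a mat \<Rightarrow> 'a) \<Rightarrow> bool" where
  "right_linear_on D \<phi> \<longleftrightarrow>
     (\<forall>x\<in>D. \<forall>y\<in>D. \<forall>a b. \<phi> (x \<cdot>\<^sub>r a + y \<cdot>\<^sub>r b) = \<phi> x * a + \<phi> y * b)"

definition exact_semiring :: "'a::local_semiring itself \<Rightarrow> bool" where
  "exact_semiring _ \<longleftrightarrow>
     (\<forall>m > 0. \<forall>n > 0. \<forall>A :: 'a mat \<in> carrier_mat m n.
        (\<forall>x \<in> carrier_mat 1 n - row_space A.
           \<exists>v \<in> carrier_mat n 1. \<exists>v' \<in> carrier_mat n 1. A *\<^sub>m v = A *\<^sub>m v' \<and> x *\<^sub>m v \<noteq> x *\<^sub>m v') \<and>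
        (\<forall>y \<in> carrier_mat m 1 - col_space A.
           \<exists>u \<in> carrier_mat 1 m. \<exists>u' \<in> carrier_mat 1 m. u *\<^sub>m A = u' *\<^sub>m A \<and> u *\<^sub>m y \<noteq> u' *\<^sub>m y))"

end

theory Submission
  imports Defs
begin

text \<open>
  Each of the two equivalences E1 \<open>\<longleftrightarrow>\<close> H1 and E2 \<open>\<longleftrightarrow>\<close> H2 holds for every single matrix \<open>A\<close>.

  A right linear \<open>\<phi>\<close> on the column space of \<open>A\<close> is determined by its values on the columns of \<open>A\<close>:
  if \<open>x\<close> is the row of these values, then \<open>\<phi> (A v) = x v\<close> for all \<open>v\<close>
  (\<open>right_linear_on_col_space\<close>). Hence \<open>A v = A v'\<close> implies \<open>x v = x v'\<close>. If E1 holds, then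
  \<open>x = u A\<close> for some \<open>u\<close>, and \<open>y \<mapsto> u y\<close> is the required extension of \<open>\<phi>\<close>.

  Conversely, suppose that \<open>A v = A v'\<close> always implies \<open>x v = x v'\<close>. Then \<open>A v \<mapsto> x v\<close> is a
  well-defined right linear function, which under H1 extends to some \<open>\<psi>\<close> on all columns. On the
  columns whose entries lie in a given finite set, \<open>\<psi>\<close> is multiplication by a row
  (\<open>right_linear_on_eq_row\<close>, the first representation applied to a local identity matrix). For the
  columns of \<open>A\<close> this row \<open>u\<close> satisfies \<open>u A = x\<close>, so \<open>x\<close> lies in the row space.

  The equivalence E2 \<open>\<longleftrightarrow>\<close> H2 for \<open>A\<close> is E1 \<open>\<longleftrightarrow>\<close> H1 for the transpose of \<open>A\<close> over the opposite
  semiring.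
\<close>

section \<open>Finite sums without a zero\<close>

lemma sum_upto_cong: "(\<And>i. i \<le> k \<Longrightarrow> f i = g i) \<Longrightarrow> sum_upto f k = sum_upto g k"
  by (induction k) auto

lemma sum_upto_distrib_left: "(a::'a::semiring) * sum_upto f k = sum_upto (\<lambda>i. a * f i) k"
  by (induction k) (auto simp: distrib_left)

lemma sum_upto_distrib_right: "sum_upto f k * (a::'a::semiring) = sum_upto (\<lambda>i. f i * a) k"
  by (induction k) (auto simp: distrib_right)

lemma sum_upto_add:
  "sum_upto (\<lambda>i. f i + g i) k = sum_upto f k + (sum_upto g k :: 'a::ab_semigroup_add)"
  by (induction k) (auto simp: ac_simps)

lemma sum_upto_swap:
  "sum_upto (\<lambda>i. sum_upto (f i) l) k = sum_upto (\<lambda>j. sum_upto (\<lambda>i. f i j :: 'a::ab_semigroup_add) k) l"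
  by (induction k) (auto simp: sum_upto_add)

lemma add_sum_upto_absorb:
  assumes "\<And>i. i \<le> k \<Longrightarrow> (a::'a::semigroup_add) + c i = a"
  shows "a + sum_upto c k = a"
  using assms
proof (induction k)
  case (Suc k)
  then have "a + sum_upto c k = a" "a + c (Suc k) = a" by auto
  then show ?case by (simp flip: add.assoc)
qed auto

lemma sum_upto_single:
  assumes "j \<le> k" "\<And>i. i \<le> k \<Longrightarrow> i \<noteq> j \<Longrightarrow> g j + g i = (g j :: 'a::ab_semigroup_add)"
  shows "sum_upto g k = g j"
  using assms
proof (induction k)
  case (Suc k)
  show ?case
  proof (cases "j = Suc k")
    case True
    have "g j + sum_upto g k = g j"
      using True Suc.prems(2) by (intro add_sum_upto_absorb) auto
    then show ?thesis using True by (simp add: add.commute)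
  next
    case False
    then have "sum_upto g k = g j" using Suc by auto
    then show ?thesis using Suc.prems(2)[of "Suc k"] False by auto
  qed
qed auto

section \<open>Matrix products and column spaces\<close>

lemma mat_prod_carrier [intro]:
  "A \<in> carrier_mat m n \<Longrightarrow> B \<in> carrier_mat k l \<Longrightarrow> A *\<^sub>m B \<in> carrier_mat m l"
  by (auto simp: mat_prod_def)

lemma index_mat_prod:
  "A \<in> carrier_mat m n \<Longrightarrow> B \<in> carrier_mat k l \<Longrightarrow> i < m \<Longrightarrow> j < l \<Longrightarrow>
    (A *\<^sub>m B) $$ (i, j) = sum_upto (\<lambda>k. A $$ (i, k) * B $$ (k, j)) (n - 1)"
  by (auto simp: mat_prod_def)

lemma right_smult_carrier [simp, intro]: "A \<in> carrier_mat m n \<Longrightarrow> A \<cdot>\<^sub>r a \<in> carrier_mat m n"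
  by (auto simp: right_smult_mat_def)

lemma mat_prod_assoc:
  assumes A: "A \<in> carrier_mat k m" and B: "B \<in> carrier_mat m n" and C: "C \<in> carrier_mat n l"
    and pos: "m > 0" "n > 0"
  shows "(A *\<^sub>m B) *\<^sub>m C = A *\<^sub>m (B *\<^sub>m C)"
proof (rule eq_matI)
  note AB = mat_prod_carrier[OF A B] and BC = mat_prod_carrier[OF B C]
  fix i j assume "i < dim_row (A *\<^sub>m (B *\<^sub>m C))" "j < dim_col (A *\<^sub>m (B *\<^sub>m C))"
  then have ij: "i < k" "j < l" using A C by (auto simp: mat_prod_def)
  have "((A *\<^sub>m B) *\<^sub>m C) $$ (i, j) =
      sum_upto (\<lambda>q. sum_upto (\<lambda>p. A $$ (i, p) * B $$ (p, q) * C $$ (q, j)) (m - 1)) (n - 1)"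
    unfolding index_mat_prod[OF AB C ij]
    by (rule sum_upto_cong)
      (use pos ij in \<open>simp add: index_mat_prod[OF A B] sum_upto_distrib_right\<close>)
  also have "\<dots> = sum_upto (\<lambda>p. sum_upto (\<lambda>q. A $$ (i, p) * B $$ (p, q) * C $$ (q, j)) (n - 1)) (m - 1)"
    by (rule sum_upto_swap)
  also have "\<dots> = (A *\<^sub>m (B *\<^sub>m C)) $$ (i, j)"
    unfolding index_mat_prod[OF A BC ij]
    by (rule sum_upto_cong)
      (use pos ij in \<open>simp add: index_mat_prod[OF B C] sum_upto_distrib_left mult.assoc\<close>)
  finally show "((A *\<^sub>m B) *\<^sub>m C) $$ (i, j) = (A *\<^sub>m (B *\<^sub>m C)) $$ (i, j)" .
qed (use A B C in \<open>auto simp: mat_prod_def\<close>)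

lemma mat_prod_right_lincomb:
  assumes A: "A \<in> carrier_mat m n" and v: "v \<in> carrier_mat n l" and w: "w \<in> carrier_mat n l"
    and pos: "n > 0"
  shows "A *\<^sub>m (v \<cdot>\<^sub>r a + w \<cdot>\<^sub>r b) = (A *\<^sub>m v) \<cdot>\<^sub>r a + (A *\<^sub>m w) \<cdot>\<^sub>r b"
proof (rule eq_matI)
  note Av = mat_prod_carrier[OF A v] and Aw = mat_prod_carrier[OF A w]
  have vw: "v \<cdot>\<^sub>r a + w \<cdot>\<^sub>r b \<in> carrier_mat n l" using v w by auto
  fix i j assume "i < dim_row ((A *\<^sub>m v) \<cdot>\<^sub>r a + (A *\<^sub>m w) \<cdot>\<^sub>r b)"
    "j < dim_col ((A *\<^sub>m v) \<cdot>\<^sub>r a + (A *\<^sub>m w) \<cdot>\<^sub>r b)"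
  then have ij: "i < m" "j < l" using A w by (auto simp: mat_prod_def right_smult_mat_def)
  have "(A *\<^sub>m (v \<cdot>\<^sub>r a + w \<cdot>\<^sub>r b)) $$ (i, j) =
      sum_upto (\<lambda>k. A $$ (i, k) * v $$ (k, j) * a + A $$ (i, k) * w $$ (k, j) * b) (n - 1)"
    unfolding index_mat_prod[OF A vw ij]
    by (rule sum_upto_cong)
      (use pos ij v w in \<open>simp add: right_smult_mat_def distrib_left mult.assoc\<close>)
  also have "\<dots> = ((A *\<^sub>m v) \<cdot>\<^sub>r a + (A *\<^sub>m w) \<cdot>\<^sub>r b) $$ (i, j)"
    using ij carrier_matD[OF Av] carrier_matD[OF Aw]
    by (simp add: sum_upto_add right_smult_mat_def index_mat_prod[OF A v] index_mat_prod[OF A w]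
        sum_upto_distrib_right)
  finally show "(A *\<^sub>m (v \<cdot>\<^sub>r a + w \<cdot>\<^sub>r b)) $$ (i, j) = ((A *\<^sub>m v) \<cdot>\<^sub>r a + (A *\<^sub>m w) \<cdot>\<^sub>r b) $$ (i, j)" .
qed (use A v w in \<open>auto simp: mat_prod_def right_smult_mat_def\<close>)

text \<open>The scalar \<open>u y\<close> is entry \<open>(0, 0)\<close> of the \<open>1 \<times> 1\<close> product.\<close>

lemma right_linear_on_mult:
  fixes u :: "'a::semiring mat"
  assumes "u \<in> carrier_mat 1 m" "m > 0"
  shows "right_linear_on (carrier_mat m 1) (\<lambda>y. (u *\<^sub>m y) $$ (0, 0))"
  unfolding right_linear_on_def
proof (intro ballI allI)
  fix x y :: "'a mat" and a b :: 'a assume x: "x \<in> carrier_mat m 1" and y: "y \<in> carrier_mat m 1"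
  note c = mat_prod_carrier[OF assms(1) x] mat_prod_carrier[OF assms(1) y]
  show "(u *\<^sub>m (x \<cdot>\<^sub>r a + y \<cdot>\<^sub>r b)) $$ (0, 0) = (u *\<^sub>m x) $$ (0, 0) * a + (u *\<^sub>m y) $$ (0, 0) * b"
    unfolding mat_prod_right_lincomb[OF assms(1) x y assms(2)]
    using carrier_matD[OF c(1)] carrier_matD[OF c(2)] by (simp add: right_smult_mat_def)
qed

lemma mat_1_1_eq_iff:
  assumes "A \<in> carrier_mat 1 1" "B \<in> carrier_mat 1 1"
  shows "A = B \<longleftrightarrow> A $$ (0, 0) = B $$ (0, 0)"
  using assms by (auto intro!: eq_matI)

lemma right_linear_on_subset: "right_linear_on D \<phi> \<Longrightarrow> C \<subseteq> D \<Longrightarrow> right_linear_on C \<phi>"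
  by (auto simp: right_linear_on_def subset_iff)

lemma col_space_eq_image:
  "A \<in> carrier_mat m n \<Longrightarrow> col_space A = (\<lambda>v. A *\<^sub>m v) ` carrier_mat n 1"
  by (auto simp: col_space_def)

lemma row_space_eq_image:
  "A \<in> carrier_mat m n \<Longrightarrow> row_space A = (\<lambda>u. u *\<^sub>m A) ` carrier_mat 1 m"
  by (auto simp: row_space_def)

lemma col_space_subset: "A \<in> carrier_mat m n \<Longrightarrow> col_space A \<subseteq> carrier_mat m 1"
  by (auto simp: col_space_def mat_prod_def)

lemma col_space_closed:
  assumes A: "A \<in> carrier_mat m n" "n > 0" and "x \<in> col_space A" "y \<in> col_space A"
  shows "x \<cdot>\<^sub>r a + y \<cdot>\<^sub>r b \<in> col_space A"
proof -
  obtain v w where v: "v \<in> carrier_mat n 1" "x = A *\<^sub>m v" and w: "w \<in> carrier_mat n 1" "y = A *\<^sub>m w"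
    using assms unfolding col_space_eq_image[OF A(1)] by blast
  have "v \<cdot>\<^sub>r a + w \<cdot>\<^sub>r b \<in> carrier_mat n 1" using v w by auto
  then show ?thesis
    unfolding col_space_eq_image[OF A(1)] v(2) w(2)
    by (intro image_eqI) (simp_all add: mat_prod_right_lincomb[OF A(1) v(1) w(1) A(2)])
qed

section \<open>Local identity matrices\<close>

lemma finite_elements_mat: "finite (elements_mat A)"
  by (simp add: elements_mat_def)

text \<open>The term \<open>z * b\<close> is absorbed only for \<open>b\<close> in \<open>L\<close>, so \<open>L\<close> must contain the factors as
  well as the summands.\<close>

lemma obtain_local_identities:
  fixes L :: "'a::local_semiring set"
  assumes "finite L"
  obtains z e where
    "\<And>a b. a \<in> L \<Longrightarrow> b \<in> L \<Longrightarrow> a + z * b = a" "\<And>a. a \<in> L \<Longrightarrow> e * a = a"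
    "\<And>a b. a \<in> L \<Longrightarrow> b \<in> L \<Longrightarrow> a + b * z = a" "\<And>a. a \<in> L \<Longrightarrow> a * e = a"
proof (cases "L = {}")
  case False
  then obtain z e where "\<forall>a\<in>L. \<forall>b\<in>L. a + z * b = a \<and> e * a = a \<and> a + b * z = a \<and> a * e = a"
    using local_identities[OF assms] by blast
  then show ?thesis by (intro that[of z e]) auto
qed (use that in blast)

text \<open>The column of index \<open>j\<close>, as a one-column matrix.\<close>

definition column :: "'a mat \<Rightarrow> nat \<Rightarrow> 'a mat" where
  "column A j = mat (dim_row A) 1 (\<lambda>(i, _). A $$ (i, j))"

lemma column_carrier [intro]: "A \<in> carrier_mat m n \<Longrightarrow> column A j \<in> carrier_mat m 1"
  by (auto simp: column_def)

text \<open>The identity matrix of size \<open>n\<close> with \<open>z\<close> in the role of zero and \<open>e\<close> in that of one.\<close>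

definition local_one :: "nat \<Rightarrow> 'a \<Rightarrow> 'a \<Rightarrow> 'a mat" where
  "local_one n z e = mat n n (\<lambda>(i, j). if i = j then e else z)"

lemma local_one_carrier [intro]: "local_one n z e \<in> carrier_mat n n"
  by (auto simp: local_one_def)

lemma local_one_mult:
  fixes B :: "'a::semiring mat"
  assumes B: "B \<in> carrier_mat n l" and
    id: "\<And>a b. a \<in> elements_mat B \<Longrightarrow> b \<in> elements_mat B \<Longrightarrow> a + z * b = a"
    "\<And>a. a \<in> elements_mat B \<Longrightarrow> e * a = a"
  shows "local_one n z e *\<^sub>m B = B"
proof (rule eq_matI)
  note O = local_one_carrier[of n z e]
  fix i j assume "i < dim_row B" "j < dim_col B"
  then have ij: "i < n" "j < l" and el: "B $$ (i, j) \<in> elements_mat B" using B by auto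
  let ?g = "\<lambda>k. local_one n z e $$ (i, k) * B $$ (k, j)"
  have "?g i = B $$ (i, j)" using ij id(2)[OF el] by (simp add: local_one_def)
  moreover have "sum_upto ?g (n - 1) = ?g i"
  proof (rule sum_upto_single)
    fix k assume k: "k \<le> n - 1" "k \<noteq> i"
    then have "B $$ (k, j) \<in> elements_mat B"
      using ij by (intro elements_matI[OF B, of k j]) auto
    then show "?g i + ?g k = ?g i"
      using k ij id(2)[OF el] id(1)[OF el] by (simp add: local_one_def)
  qed (use ij in auto)
  ultimately show "(local_one n z e *\<^sub>m B) $$ (i, j) = B $$ (i, j)"
    using ij by (simp add: index_mat_prod[OF O B])
qed (use B in \<open>auto simp: mat_prod_def local_one_def\<close>)

lemma mult_local_one:
  fixes A :: "'a::semiring mat"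
  assumes A: "A \<in> carrier_mat m n" and
    id: "\<And>a b. a \<in> elements_mat A \<Longrightarrow> b \<in> elements_mat A \<Longrightarrow> a + b * z = a"
    "\<And>a. a \<in> elements_mat A \<Longrightarrow> a * e = a"
  shows "A *\<^sub>m local_one n z e = A"
proof (rule eq_matI)
  note O = local_one_carrier[of n z e]
  fix i j assume "i < dim_row A" "j < dim_col A"
  then have ij: "i < m" "j < n" and el: "A $$ (i, j) \<in> elements_mat A" using A by auto
  let ?g = "\<lambda>k. A $$ (i, k) * local_one n z e $$ (k, j)"
  have "?g j = A $$ (i, j)" using ij id(2)[OF el] by (simp add: local_one_def)
  moreover have "sum_upto ?g (n - 1) = ?g j"
  proof (rule sum_upto_single)
    fix k assume k: "k \<le> n - 1" "k \<noteq> j"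
    then have "A $$ (i, k) \<in> elements_mat A"
      using ij by (intro elements_matI[OF A, of i k]) auto
    then show "?g j + ?g k = ?g j"
      using k ij id(2)[OF el] id(1)[OF el] by (simp add: local_one_def)
  qed (use ij in auto)
  ultimately show "(A *\<^sub>m local_one n z e) $$ (i, j) = A $$ (i, j)"
    using ij by (simp add: index_mat_prod[OF A O])
qed (use A in \<open>auto simp: mat_prod_def local_one_def\<close>)

lemma mat_prod_column:
  assumes "A \<in> carrier_mat m n" "B \<in> carrier_mat n l" "j < l" "n > 0"
  shows "A *\<^sub>m column B j = column (A *\<^sub>m B) j"
  using assms
  by (intro eq_matI) (auto simp: mat_prod_def column_def intro!: sum_upto_cong)

lemma mat_prod_column_local_one:
  fixes A :: "'a::semiring mat"
  assumes "A \<in> carrier_mat m n" "j < n"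
    "\<And>a b. a \<in> elements_mat A \<Longrightarrow> b \<in> elements_mat A \<Longrightarrow> a + b * z = a"
    "\<And>a. a \<in> elements_mat A \<Longrightarrow> a * e = a"
  shows "A *\<^sub>m column (local_one n z e) j = column A j"
  using assms by (simp add: mat_prod_column[OF _ local_one_carrier] mult_local_one)

lemma column_in_col_space:
  fixes A :: "'a::local_semiring mat"
  assumes "A \<in> carrier_mat m n" "j < n"
  shows "column A j \<in> col_space A"
proof -
  obtain z e where
    "\<And>a b. a \<in> elements_mat A \<Longrightarrow> b \<in> elements_mat A \<Longrightarrow> a + b * z = a"
    "\<And>a. a \<in> elements_mat A \<Longrightarrow> a * e = a"
    by (rule obtain_local_identities[OF finite_elements_mat[of A]]) blast
  then have "A *\<^sub>m column (local_one n z e) j = column A j"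
    using assms by (intro mat_prod_column_local_one)
  then show ?thesis
    using assms column_carrier[OF local_one_carrier, of n z e j]
    by (auto simp: col_space_def intro!: exI[of _ "column (local_one n z e) j"])
qed

section \<open>Right linear functions as rows\<close>

text \<open>Partial sums of \<open>A v = \<Sum>\<^sub>j A\<^sub>j v\<^sub>j\<close> stay in the column space; \<open>\<phi>\<close> is pushed through
  them one summand at a time.\<close>

lemma right_linear_on_col_space:
  fixes A :: "'a::local_semiring mat"
  assumes A: "A \<in> carrier_mat m n" "n > 0" and lin: "right_linear_on (col_space A) \<phi>"
    and v: "v \<in> carrier_mat n 1"
  shows "\<phi> (A *\<^sub>m v) = (mat 1 n (\<lambda>(_, j). \<phi> (column A j)) *\<^sub>m v) $$ (0, 0)"
proof -
  define s where "s k = mat m 1 (\<lambda>(i, _). sum_upto (\<lambda>j. A $$ (i, j) * v $$ (j, 0)) k)" for k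
  have lin': "\<phi> (x \<cdot>\<^sub>r a + y \<cdot>\<^sub>r b) = \<phi> x * a + \<phi> y * b"
    if "x \<in> col_space A" "y \<in> col_space A" for x y a b
    using lin that by (simp add: right_linear_on_def)
  have "s k \<in> col_space A \<and> \<phi> (s k) = sum_upto (\<lambda>j. \<phi> (column A j) * v $$ (j, 0)) k"
    if "k < n" for k
    using that
  proof (induction k)
    case 0
    let ?c = "column A 0" and ?v = "v $$ (0, 0)"
    have c: "?c \<in> col_space A" using A by (intro column_in_col_space)
    define L where "L = {\<phi> ?c, \<phi> ?c * ?v} \<union> elements_mat A \<union> elements_mat (s 0)"
    have "finite L" by (simp add: L_def finite_elements_mat)
    then obtain z where z: "\<And>a b. a \<in> L \<Longrightarrow> b \<in> L \<Longrightarrow> a + b * z = a"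
      by (rule obtain_local_identities) blast
    \<comment> \<open>\<open>\<phi>\<close> respects binary combinations only, so a single term needs a second, absorbed one.\<close>
    have "s 0 = ?c \<cdot>\<^sub>r ?v + ?c \<cdot>\<^sub>r z"
    proof (rule eq_matI)
      fix i j assume "i < dim_row (?c \<cdot>\<^sub>r ?v + ?c \<cdot>\<^sub>r z)" "j < dim_col (?c \<cdot>\<^sub>r ?v + ?c \<cdot>\<^sub>r z)"
      then have ij: "i < m" "j = 0" using A by (auto simp: right_smult_mat_def column_def)
      then have "s 0 $$ (i, 0) \<in> L" "A $$ (i, 0) \<in> L" using A by (auto simp: s_def L_def)
      then have "s 0 $$ (i, 0) = s 0 $$ (i, 0) + A $$ (i, 0) * z" using z by simp
      then show "s 0 $$ (i, j) = (?c \<cdot>\<^sub>r ?v + ?c \<cdot>\<^sub>r z) $$ (i, j)"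
        using ij A by (simp add: s_def right_smult_mat_def column_def)
    qed (use A in \<open>auto simp: s_def right_smult_mat_def column_def\<close>)
    then show ?case
      using col_space_closed[OF A c c] lin'[OF c c] z by (simp add: L_def)
  next
    case (Suc k)
    let ?c = "column A (Suc k)" and ?v = "v $$ (Suc k, 0)"
    have sk: "s k \<in> col_space A" using Suc by simp
    have c: "?c \<in> col_space A" using A Suc.prems by (intro column_in_col_space)
    have "finite (insert (\<phi> (s k)) (elements_mat (s k)))" by (simp add: finite_elements_mat)
    then obtain e where e: "\<And>a. a \<in> insert (\<phi> (s k)) (elements_mat (s k)) \<Longrightarrow> a * e = a"
      by (rule obtain_local_identities) blast
    have "s (Suc k) = s k \<cdot>\<^sub>r e + ?c \<cdot>\<^sub>r ?v"
    proof (rule eq_matI)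
      fix i j assume "i < dim_row (s k \<cdot>\<^sub>r e + ?c \<cdot>\<^sub>r ?v)" "j < dim_col (s k \<cdot>\<^sub>r e + ?c \<cdot>\<^sub>r ?v)"
      then have ij: "i < m" "j = 0" using A by (auto simp: right_smult_mat_def column_def)
      then have "s k $$ (i, 0) \<in> elements_mat (s k)" by (auto simp: s_def)
      then have "s k $$ (i, 0) * e = s k $$ (i, 0)" using e by simp
      then show "s (Suc k) $$ (i, j) = (s k \<cdot>\<^sub>r e + ?c \<cdot>\<^sub>r ?v) $$ (i, j)"
        using ij A by (simp add: s_def right_smult_mat_def column_def)
    qed (use A in \<open>auto simp: s_def right_smult_mat_def column_def\<close>)
    then show ?case
      using col_space_closed[OF A sk c] lin'[OF sk c] e Suc by simp
  qed
  from this[of "n - 1"]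
  have "\<phi> (s (n - 1)) = sum_upto (\<lambda>j. \<phi> (column A j) * v $$ (j, 0)) (n - 1)" using A by simp
  moreover have "s (n - 1) = A *\<^sub>m v"
    using A v by (intro eq_matI) (auto simp: s_def mat_prod_def)
  moreover have "(mat 1 n (\<lambda>(_, j). \<phi> (column A j)) *\<^sub>m v) $$ (0, 0) =
      sum_upto (\<lambda>j. \<phi> (column A j) * v $$ (j, 0)) (n - 1)"
    using A v by (auto simp: mat_prod_def intro!: sum_upto_cong)
  ultimately show ?thesis by simp
qed

text \<open>Without a global identity, a right linear function is a row only locally: \<open>u\<close> depends on the
  finite set \<open>L\<close>.\<close>

lemma right_linear_on_eq_row:
  fixes \<psi> :: "'a::local_semiring mat \<Rightarrow> 'a"
  assumes lin: "right_linear_on (carrier_mat m 1) \<psi>" and m: "m > 0" and L: "finite L"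
  obtains u where "u \<in> carrier_mat 1 m"
    "\<And>y. y \<in> carrier_mat m 1 \<Longrightarrow> elements_mat y \<subseteq> L \<Longrightarrow> \<psi> y = (u *\<^sub>m y) $$ (0, 0)"
proof -
  obtain z e where z: "\<And>a b. a \<in> L \<Longrightarrow> b \<in> L \<Longrightarrow> a + z * b = a" and e: "\<And>a. a \<in> L \<Longrightarrow> e * a = a"
    by (rule obtain_local_identities[OF L]) blast
  let ?I = "local_one m z e"
  let ?u = "mat 1 m (\<lambda>(_, j). \<psi> (column ?I j))"
  have "right_linear_on (col_space ?I) \<psi>"
    using lin col_space_subset[OF local_one_carrier] by (rule right_linear_on_subset)
  then have "\<psi> (?I *\<^sub>m y) = (?u *\<^sub>m y) $$ (0, 0)" if "y \<in> carrier_mat m 1" for y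
    using that m by (intro right_linear_on_col_space) auto
  moreover have "?I *\<^sub>m y = y" if "y \<in> carrier_mat m 1" "elements_mat y \<subseteq> L" for y
    using that(1)
    by (rule local_one_mult) (use that(2) z e in \<open>blast+\<close>)
  ultimately show thesis by (intro that[of ?u]) (simp, metis)
qed

section \<open>Exactness and extension for a single matrix\<close>

lemma extension_if_exact:
  fixes A :: "'a::local_semiring mat"
  assumes A: "A \<in> carrier_mat m n" and m: "m > 0" and n: "n > 0"
    and exact: "\<And>x. x \<in> carrier_mat 1 n - row_space A \<Longrightarrow>
      \<exists>v \<in> carrier_mat n 1. \<exists>v' \<in> carrier_mat n 1. A *\<^sub>m v = A *\<^sub>m v' \<and> x *\<^sub>m v \<noteq> x *\<^sub>m v'"
    and lin: "right_linear_on (col_space A) \<phi>"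
  shows "\<exists>\<psi>. right_linear_on (carrier_mat m 1) \<psi> \<and> (\<forall>y \<in> col_space A. \<psi> y = \<phi> y)"
proof -
  let ?x = "mat 1 n (\<lambda>(_, j). \<phi> (column A j))"
  have x: "?x \<in> carrier_mat 1 n" by simp
  have rep: "\<phi> (A *\<^sub>m v) = (?x *\<^sub>m v) $$ (0, 0)" if "v \<in> carrier_mat n 1" for v
    using A n lin that by (rule right_linear_on_col_space)
  have "?x *\<^sub>m v = ?x *\<^sub>m v'"
    if "v \<in> carrier_mat n 1" "v' \<in> carrier_mat n 1" "A *\<^sub>m v = A *\<^sub>m v'" for v v'
    using that rep[of v] rep[of v']
    by (subst mat_1_1_eq_iff[OF mat_prod_carrier[OF x] mat_prod_carrier[OF x]]) auto
  then have "?x \<in> row_space A" using exact x by blast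
  then obtain u where u: "u \<in> carrier_mat 1 m" "?x = u *\<^sub>m A"
    unfolding row_space_eq_image[OF A] by blast
  have "(u *\<^sub>m y) $$ (0, 0) = \<phi> y" if "y \<in> col_space A" for y
  proof -
    obtain v where v: "v \<in> carrier_mat n 1" "y = A *\<^sub>m v"
      using \<open>y \<in> _\<close> unfolding col_space_eq_image[OF A] by blast
    then show ?thesis using rep[OF v(1)] u mat_prod_assoc[OF u(1) A v(1) m n] by simp
  qed
  then show ?thesis using right_linear_on_mult[OF u(1) m] by blast
qed

lemma row_space_if_extension:
  fixes A :: "'a::local_semiring mat"
  assumes A: "A \<in> carrier_mat m n" and m: "m > 0" and n: "n > 0"
    and ext: "\<And>\<phi>. right_linear_on (col_space A) \<phi> \<Longrightarrow>
      \<exists>\<psi>. right_linear_on (carrier_mat m 1) \<psi> \<and> (\<forall>y \<in> col_space A. \<psi> y = \<phi> y)"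
    and x: "x \<in> carrier_mat 1 n"
    and eq: "\<And>v v'. v \<in> carrier_mat n 1 \<Longrightarrow> v' \<in> carrier_mat n 1 \<Longrightarrow> A *\<^sub>m v = A *\<^sub>m v' \<Longrightarrow>
      x *\<^sub>m v = x *\<^sub>m v'"
  shows "x \<in> row_space A"
proof -
  define \<phi> where "\<phi> y = (x *\<^sub>m (SOME v. v \<in> carrier_mat n 1 \<and> A *\<^sub>m v = y)) $$ (0, 0)" for y
  have \<phi>: "\<phi> (A *\<^sub>m v) = (x *\<^sub>m v) $$ (0, 0)" if v: "v \<in> carrier_mat n 1" for v
  proof -
    let ?w = "SOME w. w \<in> carrier_mat n 1 \<and> A *\<^sub>m w = A *\<^sub>m v"
    have "?w \<in> carrier_mat n 1 \<and> A *\<^sub>m ?w = A *\<^sub>m v"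
      by (rule someI[of _ v]) (use v in simp)
    then show ?thesis using eq[of ?w v] v by (simp add: \<phi>_def)
  qed
  have "right_linear_on (col_space A) \<phi>"
    unfolding right_linear_on_def
  proof (intro ballI allI)
    fix y y' and a b :: 'a assume "y \<in> col_space A" "y' \<in> col_space A"
    then obtain v v' where v: "v \<in> carrier_mat n 1" "y = A *\<^sub>m v" "v' \<in> carrier_mat n 1" "y' = A *\<^sub>m v'"
      unfolding col_space_eq_image[OF A] by blast
    then have c: "v \<cdot>\<^sub>r a + v' \<cdot>\<^sub>r b \<in> carrier_mat n 1" by auto
    have "\<phi> (y \<cdot>\<^sub>r a + y' \<cdot>\<^sub>r b) = (x *\<^sub>m (v \<cdot>\<^sub>r a + v' \<cdot>\<^sub>r b)) $$ (0, 0)"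
      using \<phi>[OF c] mat_prod_right_lincomb[OF A v(1,3) n, of a b] v by simp
    also have "\<dots> = \<phi> y * a + \<phi> y' * b"
      using right_linear_on_mult[OF x n] v \<phi> by (simp add: right_linear_on_def)
    finally show "\<phi> (y \<cdot>\<^sub>r a + y' \<cdot>\<^sub>r b) = \<phi> y * a + \<phi> y' * b" .
  qed
  then obtain \<psi> where \<psi>: "right_linear_on (carrier_mat m 1) \<psi>" "\<And>y. y \<in> col_space A \<Longrightarrow> \<psi> y = \<phi> y"
    using ext by blast
  obtain u where u: "u \<in> carrier_mat 1 m"
    "\<And>y. y \<in> carrier_mat m 1 \<Longrightarrow> elements_mat y \<subseteq> elements_mat A \<Longrightarrow> \<psi> y = (u *\<^sub>m y) $$ (0, 0)"
    by (rule right_linear_on_eq_row[OF \<psi>(1) m finite_elements_mat[of A]]) blast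
  have "finite (elements_mat A \<union> elements_mat x)" by (simp add: finite_elements_mat)
  then obtain z e where
    z: "\<And>a b. a \<in> elements_mat A \<union> elements_mat x \<Longrightarrow>
      b \<in> elements_mat A \<union> elements_mat x \<Longrightarrow> a + b * z = a" and
    e: "\<And>a. a \<in> elements_mat A \<union> elements_mat x \<Longrightarrow> a * e = a"
    by (rule obtain_local_identities) blast
  \<comment> \<open>Entry \<open>j\<close> is compared by evaluating at a local unit column \<open>e\<^sub>j\<close>: there \<open>A e\<^sub>j\<close> is
    column \<open>j\<close> of \<open>A\<close> and \<open>x e\<^sub>j\<close> is entry \<open>j\<close> of \<open>x\<close>.\<close>
  have "x = u *\<^sub>m A"
  proof (rule eq_matI)
    fix i j assume "i < dim_row (u *\<^sub>m A)" "j < dim_col (u *\<^sub>m A)"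
    then have ij: "i = 0" "j < n" using u A by (auto simp: mat_prod_def)
    let ?e = "column (local_one n z e) j"
    have unit: "A *\<^sub>m ?e = column A j" "x *\<^sub>m ?e = column x j"
      using A x ij z e by (auto intro!: mat_prod_column_local_one)
    have sub: "elements_mat (column A j) \<subseteq> elements_mat A"
      using A ij by (force simp: elements_mat_def column_def)
    have "x $$ (i, j) = (x *\<^sub>m ?e) $$ (0, 0)"
      unfolding unit(2) using ij x by (simp add: column_def)
    also have "\<dots> = \<phi> (column A j)"
      using \<phi>[OF column_carrier[OF local_one_carrier], of z e j] by (simp only: unit)
    also have "\<dots> = \<psi> (column A j)" using \<psi>(2) column_in_col_space[OF A ij(2)] by simp
    also have "\<dots> = (u *\<^sub>m column A j) $$ (0, 0)" by (rule u(2)[OF column_carrier[OF A] sub])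
    also have "\<dots> = (u *\<^sub>m A) $$ (i, j)"
      using mat_prod_column[OF u(1) A ij(2) m] u ij by (simp add: column_def mat_prod_def)
    finally show "x $$ (i, j) = (u *\<^sub>m A) $$ (i, j)" .
  qed (use x u A in \<open>auto simp: mat_prod_def\<close>)
  then show ?thesis using u unfolding row_space_eq_image[OF A] by blast
qed

lemma exact_iff_extension:
  fixes A :: "'a::local_semiring mat"
  assumes "A \<in> carrier_mat m n" "m > 0" "n > 0"
  shows "(\<forall>x \<in> carrier_mat 1 n - row_space A.
      \<exists>v \<in> carrier_mat n 1. \<exists>v' \<in> carrier_mat n 1. A *\<^sub>m v = A *\<^sub>m v' \<and> x *\<^sub>m v \<noteq> x *\<^sub>m v') \<longleftrightarrow>
    (\<forall>\<phi> :: 'a mat \<Rightarrow> 'a. right_linear_on (col_space A) \<phi> \<longrightarrow>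
      (\<exists>\<psi>. right_linear_on (carrier_mat m 1) \<psi> \<and> (\<forall>y \<in> col_space A. \<psi> y = \<phi> y)))"
    (is "?E \<longleftrightarrow> ?H")
proof
  assume ?E
  then show ?H using extension_if_exact[OF assms] by blast
next
  assume H: ?H
  show ?E
  proof (rule ballI, rule ccontr)
    fix x assume x: "x \<in> carrier_mat 1 n - row_space A"
      and "\<not> (\<exists>v \<in> carrier_mat n 1. \<exists>v' \<in> carrier_mat n 1. A *\<^sub>m v = A *\<^sub>m v' \<and> x *\<^sub>m v \<noteq> x *\<^sub>m v')"
    then have "x \<in> row_space A"
      using H by (intro row_space_if_extension[OF assms]) blast+
    then show False using x by simp
  qed
qed

section \<open>The opposite semiring\<close>

text \<open>The semiring with the same addition and the reversed multiplication, as a type of its own, so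
  that it is an instance of the same classes.\<close>

datatype 'a opposite = Op (unop: 'a)

instantiation opposite :: (semiring) semiring
begin

definition "a + b = Op (unop a + unop b)"

definition "a * b = Op (unop b * unop a)"

instance
  by standard (auto simp: plus_opposite_def times_opposite_def algebra_simps)

end

instance opposite :: (local_semiring) local_semiring
proof
  fix L :: "'a opposite set" assume "finite L" "L \<noteq> {}"
  then have "finite (unop ` L)" by simp
  then obtain z e where id:
    "\<And>a b. a \<in> unop ` L \<Longrightarrow> b \<in> unop ` L \<Longrightarrow> a + z * b = a" "\<And>a. a \<in> unop ` L \<Longrightarrow> e * a = a"
    "\<And>a b. a \<in> unop ` L \<Longrightarrow> b \<in> unop ` L \<Longrightarrow> a + b * z = a" "\<And>a. a \<in> unop ` L \<Longrightarrow> a * e = a"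
    by (rule obtain_local_identities) blast
  show "\<exists>z e. \<forall>a\<in>L. \<forall>b\<in>L. a + z * b = a \<and> e * a = a \<and> a + b * z = a \<and> a * e = a"
    by (rule exI[of _ "Op z"], rule exI[of _ "Op e"])
      (simp add: plus_opposite_def times_opposite_def id)
qed

text \<open>Transposition, read as a map to matrices over the opposite semiring, reverses products.\<close>

definition op_transpose :: "'a mat \<Rightarrow> 'a opposite mat" where
  "op_transpose A = map_mat Op (transpose_mat A)"

definition unop_transpose :: "'a opposite mat \<Rightarrow> 'a mat" where
  "unop_transpose A = map_mat unop (transpose_mat A)"

lemma unop_eq_iff: "unop a = unop b \<longleftrightarrow> a = b"
  by (auto intro: opposite.expand)

lemma unop_op_transpose [simp]: "unop_transpose (op_transpose A) = A"
  by (rule eq_matI) (auto simp: op_transpose_def unop_transpose_def)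

lemma op_unop_transpose [simp]: "op_transpose (unop_transpose A) = A"
  by (rule eq_matI) (auto simp: op_transpose_def unop_transpose_def)

lemma op_transpose_eq_iff [simp]: "op_transpose A = op_transpose B \<longleftrightarrow> A = B"
  by (metis unop_op_transpose)

lemma op_transpose_carrier_iff [simp]:
  "op_transpose A \<in> carrier_mat m n \<longleftrightarrow> A \<in> carrier_mat n m"
  by (auto simp: op_transpose_def)

lemma carrier_mat_opposite: "carrier_mat m n = op_transpose ` carrier_mat n m"
proof (intro equalityI subsetI)
  fix B :: "'a opposite mat" assume "B \<in> carrier_mat m n"
  then have "unop_transpose B \<in> carrier_mat n m"
    using op_transpose_carrier_iff[of "unop_transpose B" m n] by simp
  then show "B \<in> op_transpose ` carrier_mat n m"
    by (intro image_eqI[of _ _ "unop_transpose B"]) simp_all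
qed auto

lemma sum_upto_opposite: "sum_upto (\<lambda>i. Op (f i)) k = Op (sum_upto f k :: 'a::semiring)"
  by (induction k) (auto simp: plus_opposite_def)

lemma op_transpose_mat_prod:
  assumes A: "A \<in> carrier_mat m n" and B: "B \<in> carrier_mat n l" and n: "n > 0"
  shows "op_transpose (A *\<^sub>m B) = op_transpose B *\<^sub>m op_transpose A"
proof (rule eq_matI)
  fix i j assume "i < dim_row (op_transpose B *\<^sub>m op_transpose A)"
    "j < dim_col (op_transpose B *\<^sub>m op_transpose A)"
  then have ij: "i < l" "j < m" using A B by (auto simp: mat_prod_def op_transpose_def)
  have "(op_transpose B *\<^sub>m op_transpose A) $$ (i, j) =
      sum_upto (\<lambda>k. op_transpose B $$ (i, k) * op_transpose A $$ (k, j)) (n - 1)"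
    using A B ij by (intro index_mat_prod) auto
  also have "\<dots> = sum_upto (\<lambda>k. Op (A $$ (j, k) * B $$ (k, i))) (n - 1)"
    using A B ij n by (intro sum_upto_cong) (auto simp: op_transpose_def times_opposite_def)
  also have "\<dots> = op_transpose (A *\<^sub>m B) $$ (i, j)"
    using A B ij by (simp add: sum_upto_opposite op_transpose_def mat_prod_def)
  finally show "op_transpose (A *\<^sub>m B) $$ (i, j) = (op_transpose B *\<^sub>m op_transpose A) $$ (i, j)"
    by simp
qed (use A B in \<open>auto simp: mat_prod_def op_transpose_def\<close>)

lemma row_space_op_transpose:
  assumes "A \<in> carrier_mat m n" "n > 0"
  shows "row_space (op_transpose A) = op_transpose ` col_space A"
proof -
  have "row_space (op_transpose A) = (\<lambda>u. u *\<^sub>m op_transpose A) ` carrier_mat 1 n"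
    using assms by (intro row_space_eq_image) simp
  also have "\<dots> = (\<lambda>v. op_transpose (A *\<^sub>m v)) ` carrier_mat n 1"
    unfolding carrier_mat_opposite[of 1 n] image_image
    by (rule image_cong) (use assms in \<open>auto simp: op_transpose_mat_prod\<close>)
  also have "\<dots> = op_transpose ` col_space A" using assms by (simp add: col_space_eq_image image_image)
  finally show ?thesis .
qed

lemma col_space_op_transpose:
  assumes "A \<in> carrier_mat m n" "m > 0"
  shows "col_space (op_transpose A) = op_transpose ` row_space A"
proof -
  have "col_space (op_transpose A) = (\<lambda>v. op_transpose A *\<^sub>m v) ` carrier_mat m 1"
    using assms by (intro col_space_eq_image) simp
  also have "\<dots> = (\<lambda>u. op_transpose (u *\<^sub>m A)) ` carrier_mat 1 m"
    unfolding carrier_mat_opposite[of m 1] image_image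
    by (rule image_cong) (use assms in \<open>auto simp: op_transpose_mat_prod\<close>)
  also have "\<dots> = op_transpose ` row_space A" using assms by (simp add: row_space_eq_image image_image)
  finally show ?thesis .
qed

lemma op_transpose_lincomb:
  assumes "x \<in> carrier_mat m n" "y \<in> carrier_mat m n"
  shows "op_transpose x \<cdot>\<^sub>r a + op_transpose y \<cdot>\<^sub>r b = op_transpose (unop a \<cdot>\<^sub>m x + unop b \<cdot>\<^sub>m y)"
  using assms
  by (intro eq_matI)
    (auto simp: op_transpose_def right_smult_mat_def plus_opposite_def times_opposite_def)

lemma right_linear_on_op_transpose:
  assumes "D \<subseteq> carrier_mat m n"
  shows "right_linear_on (op_transpose ` D) \<phi> \<longleftrightarrow> left_linear_on D (\<lambda>x. unop (\<phi> (op_transpose x)))"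
proof -
  have "right_linear_on (op_transpose ` D) \<phi> \<longleftrightarrow> (\<forall>x\<in>D. \<forall>y\<in>D. \<forall>a b.
      unop (\<phi> (op_transpose (unop a \<cdot>\<^sub>m x + unop b \<cdot>\<^sub>m y))) =
      unop a * unop (\<phi> (op_transpose x)) + unop b * unop (\<phi> (op_transpose y)))"
    using assms
    by (auto simp: right_linear_on_def op_transpose_lincomb[OF subsetD subsetD]
        plus_opposite_def times_opposite_def opposite.expand)
  also have "\<dots> \<longleftrightarrow> left_linear_on D (\<lambda>x. unop (\<phi> (op_transpose x)))"
    unfolding left_linear_on_def by (metis opposite.sel)
  finally show ?thesis .
qed

lemma dual_exact_iff_extension:
  fixes A :: "'a::local_semiring mat"
  assumes A: "A \<in> carrier_mat m n" and m: "m > 0" and n: "n > 0"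
  shows "(\<forall>y \<in> carrier_mat m 1 - col_space A.
      \<exists>u \<in> carrier_mat 1 m. \<exists>u' \<in> carrier_mat 1 m. u *\<^sub>m A = u' *\<^sub>m A \<and> u *\<^sub>m y \<noteq> u' *\<^sub>m y) \<longleftrightarrow>
    (\<forall>\<phi> :: 'a mat \<Rightarrow> 'a. left_linear_on (row_space A) \<phi> \<longrightarrow>
      (\<exists>\<psi>. left_linear_on (carrier_mat 1 n) \<psi> \<and> (\<forall>x \<in> row_space A. \<psi> x = \<phi> x)))"
    (is "?E \<longleftrightarrow> ?H")
proof -
  let ?A = "op_transpose A"
  have R: "row_space A \<subseteq> carrier_mat 1 n" using A by (auto simp: row_space_def mat_prod_def)
  have prod: "op_transpose y *\<^sub>m op_transpose u = op_transpose (u *\<^sub>m y)"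
    if "u \<in> carrier_mat 1 m" "y \<in> carrier_mat m k" for u y :: "'a mat" and k
    using op_transpose_mat_prod[OF that m] by simp
  have inj: "inj (op_transpose :: 'a mat \<Rightarrow> _)" by (rule injI) simp
  have "?E \<longleftrightarrow> (\<forall>x \<in> carrier_mat 1 m - row_space ?A.
      \<exists>v \<in> carrier_mat m 1. \<exists>v' \<in> carrier_mat m 1. ?A *\<^sub>m v = ?A *\<^sub>m v' \<and> x *\<^sub>m v \<noteq> x *\<^sub>m v')"
    unfolding row_space_op_transpose[OF A n] carrier_mat_opposite[of m 1]
      carrier_mat_opposite[of 1 m] image_set_diff[OF inj, symmetric] ball_simps bex_simps
    using A by (intro ball_cong bex_cong refl) (auto simp: prod)
  also have "\<dots> \<longleftrightarrow> (\<forall>\<phi>. right_linear_on (col_space ?A) \<phi> \<longrightarrow>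
      (\<exists>\<psi>. right_linear_on (carrier_mat n 1) \<psi> \<and> (\<forall>y \<in> col_space ?A. \<psi> y = \<phi> y)))"
    using A m n by (intro exact_iff_extension) auto
  also have "\<dots> \<longleftrightarrow> (\<forall>\<phi>. left_linear_on (row_space A) (\<lambda>x. unop (\<phi> (op_transpose x))) \<longrightarrow>
      (\<exists>\<psi>. left_linear_on (carrier_mat 1 n) (\<lambda>x. unop (\<psi> (op_transpose x))) \<and>
        (\<forall>x \<in> row_space A. unop (\<psi> (op_transpose x)) = unop (\<phi> (op_transpose x)))))"
    unfolding col_space_op_transpose[OF A m] carrier_mat_opposite[of n 1]
      right_linear_on_op_transpose[OF R] right_linear_on_op_transpose[OF order_refl] ball_simps
    by (simp only: unop_eq_iff)
  also have "\<dots> \<longleftrightarrow> ?H"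
  proof -
    \<comment> \<open>Conjugation by the transposition is a bijection between the two sets of functions.\<close>
    have surj: "\<exists>\<phi>'. \<phi> = (\<lambda>x. unop (\<phi>' (op_transpose x)))" for \<phi> :: "'a mat \<Rightarrow> 'a"
      by (rule exI[of _ "\<lambda>x. Op (\<phi> (unop_transpose x))"]) simp
    have all: "(\<forall>\<phi>. P (\<lambda>x. unop (\<phi> (op_transpose x)))) \<longleftrightarrow> (\<forall>\<phi>. P \<phi>)"
      and ex: "(\<exists>\<phi>. P (\<lambda>x. unop (\<phi> (op_transpose x)))) \<longleftrightarrow> (\<exists>\<phi>. P \<phi>)"
      for P :: "('a mat \<Rightarrow> 'a) \<Rightarrow> bool"
      using surj by metis+
    show ?thesis
      unfolding ex[of "\<lambda>\<psi>. left_linear_on (carrier_mat 1 n) \<psi> \<and>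
        (\<forall>x \<in> row_space A. \<psi> x = unop (\<phi> (op_transpose x)))" for \<phi>]
      by (rule all)
  qed
  finally show ?thesis .
qed

section \<open>The characterisation of exact semirings\<close>

theorem theorem3p4:
  "exact_semiring TYPE('a::local_semiring) \<longleftrightarrow>
     (\<forall>m > 0. \<forall>n > 0. \<forall>A \<in> carrier_mat m n.
        (\<forall>\<phi> :: 'a mat \<Rightarrow> 'a. right_linear_on (col_space A) \<phi> \<longrightarrow>
           (\<exists>\<psi>. right_linear_on (carrier_mat m 1) \<psi> \<and> (\<forall>x \<in> col_space A. \<psi> x = \<phi> x))) \<and>
        (\<forall>\<phi> :: 'a mat \<Rightarrow> 'a. left_linear_on (row_space A) \<phi> \<longrightarrow>
           (\<exists>\<psi>. left_linear_on (carrier_mat 1 n) \<psi> \<and> (\<forall>x \<in> row_space A. \<psi> x = \<phi> x))))"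
  unfolding exact_semiring_def
  by (intro all_cong ball_cong refl arg_cong2[where f = "(\<and>)"]
      exact_iff_extension dual_exact_iff_extension)

end
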